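(* Let $M$ be a nonnegative real $N\times N$ matrix defining a strongly connected graph, with dominant positive eigenvalue $\lambda$ and positive right eigenvector $\psi$, $M\psi=\lambda\psi$. Among all stochastic matrices $S$ on $M$ (with stationary probability density $\pi$), the Maximal Entropy Random Walk $$S^{\mathrm{M}}_{ij}=\frac{M_{ij}}{\lambda}\frac{\psi_j}{\psi_i}$$ is the unique one maximizing the average entropy production $$H(S)=-\sum_i \pi_i\sum_j S_{ij}\lg\!\left(\frac{S_{ij}}{M_{ij}}\right),$$ and $H(S^{\mathrm{M}})=\lg(\lambda)$.
   Context: A (weighted, possibly directed) graph on vertices $\{1,\dots,N\}$ is identified with a nonnegative real $N\times N$ matrix $M$; there is an edge from $i$ to $j$ iff $M_{ij}>0$ (self-loops allowed). The graph is strongly connected if for all $i,j$ there is $l\ge 1$ with $(M^l)_{ij}>0$. The dominant positive eigenvalue $\lambda$ is the spectral radius of $M$, and $\psi$ has all coordinates strictly positive (unique up to scaling, by Perron-Frobenius). A matrix $S$ is stochastic on $M$ if $0\le S_{ij}\le 1$, $\sum_jS_{ij}=1$ for all $i$, and $M_{ij}=0\Rightarrow S_{ij}=0$. A stationary probability density of $S$ is a nonnegative vector $\pi$ with $\sum_i\pi_i=1$ and $\sum_i\pi_iS_{ij}=\pi_j$ for all $j$. Here $\lg=\log_2$; terms of $H(S)$ with $S_{ij}=0$ (in particular those with $M_{ij}=0$) are taken to be $0$. *)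

theory Defs
  imports "Jordan_Normal_Form.Spectral_Radius"
begin

text \<open>
  Vertices are numbered \<open>0, \<dots>, n - 1\<close>, as usual for the types of matrices and vectors with
  explicit dimensions. The graph of a nonnegative matrix \<open>M\<close> has an edge from \<open>i\<close> to \<open>j\<close> iff
  \<open>M $$ (i, j) > 0\<close>.
\<close>

definition nonneg_matrix :: "nat \<Rightarrow> real mat \<Rightarrow> bool" where
  "nonneg_matrix n M \<longleftrightarrow> M \<in> carrier_mat n n \<and> (\<forall>i<n. \<forall>j<n. 0 \<le> M $$ (i, j))"

definition strongly_connected :: "nat \<Rightarrow> real mat \<Rightarrow> bool" where
  "strongly_connected n M \<longleftrightarrow> (\<forall>i<n. \<forall>j<n. \<exists>l\<ge>1. (M ^\<^sub>m l) $$ (i, j) > 0)"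

definition stochastic_on :: "nat \<Rightarrow> real mat \<Rightarrow> real mat \<Rightarrow> bool" where
  "stochastic_on n M S \<longleftrightarrow> S \<in> carrier_mat n n
     \<and> (\<forall>i<n. \<forall>j<n. 0 \<le> S $$ (i, j) \<and> S $$ (i, j) \<le> 1)
     \<and> (\<forall>i<n. (\<Sum>j<n. S $$ (i, j)) = 1)
     \<and> (\<forall>i<n. \<forall>j<n. M $$ (i, j) = 0 \<longrightarrow> S $$ (i, j) = 0)"

definition stationary_density :: "nat \<Rightarrow> real mat \<Rightarrow> real vec \<Rightarrow> bool" where
  "stationary_density n S p \<longleftrightarrow> p \<in> carrier_vec n
     \<and> (\<forall>i<n. 0 \<le> p $ i)
     \<and> (\<Sum>i<n. p $ i) = 1
     \<and> (\<forall>j<n. (\<Sum>i<n. p $ i * S $$ (i, j)) = p $ j)"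

text \<open>
  A reducible stochastic matrix can have several stationary densities, so the density \<open>p\<close> is an
  explicit argument of the average entropy production.
\<close>

definition entropy_production :: "nat \<Rightarrow> real mat \<Rightarrow> real mat \<Rightarrow> real vec \<Rightarrow> real" where
  "entropy_production n M S p =
     - (\<Sum>i<n. p $ i * (\<Sum>j<n. if S $$ (i, j) = 0 then 0
          else S $$ (i, j) * log 2 (S $$ (i, j) / M $$ (i, j))))"

definition merw :: "nat \<Rightarrow> real mat \<Rightarrow> real \<Rightarrow> real vec \<Rightarrow> real mat" where
  "merw n M lam \<psi> = mat n n (\<lambda>(i, j). M $$ (i, j) / lam * (\<psi> $ j / \<psi> $ i))"

end

(*
  Let T be the maximal entropy random walk. For S_ij > 0 we have
  lg (S_ij / M_ij) = lg (S_ij / T_ij) - lg lam + lg psi_j - lg psi_i, and the last two terms cancel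
  after averaging over a stationary density q of S. Hence H(S) is lg lam minus the q-average of the
  relative entropies of the rows of S with respect to those of T, so H(S) <= lg lam by Gibbs.
  In case of equality S and T agree on all rows in the support of q; then the support is closed
  under the edges of M, so it contains every vertex by strong connectivity.
*)
theory Submission
  imports Defs
begin

section \<open>Existence of a stationary density\<close>

text \<open>The all-ones vector is a right eigenvector of \<open>S\<close> for 1. Since
  \<open>S\<close> and its transpose share the characteristic polynomial, there is also a real left
  eigenvector \<open>v\<close> for 1. Its signs are unknown, so the density is the normalised
  entrywise absolute value of \<open>v\<close>.\<close>

lemma stationary_density_exists:
  assumes S: "S \<in> carrier_mat n n" and n: "n \<ge> 1"
    and nonneg: "\<And>i j. i < n \<Longrightarrow> j < n \<Longrightarrow> 0 \<le> S $$ (i, j)"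
    and rows: "\<And>i. i < n \<Longrightarrow> (\<Sum>j<n. S $$ (i, j)) = 1"
  shows "\<exists>p. stationary_density n S p"
proof -
  define e :: "real vec" where "e = vec n (\<lambda>_. 1)"
  have "eigenvector S e 1"
    unfolding eigenvector_def
  proof (intro conjI)
    show "e \<in> carrier_vec (dim_row S)" using S by (simp add: e_def)
    have "e $ 0 = 1" using n by (simp add: e_def)
    then show "e \<noteq> 0\<^sub>v (dim_row S)" using n S by auto
    show "S *\<^sub>v e = 1 \<cdot>\<^sub>v e"
      using S rows by (intro eq_vecI) (auto simp: e_def scalar_prod_def atLeast0LessThan)
  qed
  then have "eigenvalue S 1" by (auto simp: eigenvalue_def)
  then have "poly (char_poly (transpose_mat S)) 1 = 0"
    using eigenvalue_root_char_poly[OF S] char_poly_transpose_mat[OF S] by simp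
  then have "eigenvalue (transpose_mat S) 1"
    using eigenvalue_root_char_poly[of "transpose_mat S" n] S by simp
  then obtain v where v: "v \<in> carrier_vec n" "v \<noteq> 0\<^sub>v n" "transpose_mat S *\<^sub>v v = 1 \<cdot>\<^sub>v v"
    using S by (auto simp: eigenvalue_def eigenvector_def)
  have fix_v: "(\<Sum>i<n. v $ i * S $$ (i, j)) = v $ j" if "j < n" for j
  proof -
    have "(transpose_mat S *\<^sub>v v) $ j = v $ j" using v that by simp
    moreover have "(transpose_mat S *\<^sub>v v) $ j = (\<Sum>i<n. v $ i * S $$ (i, j))"
      using v(1) S that by (simp add: scalar_prod_def atLeast0LessThan mult.commute)
    ultimately show ?thesis by simp
  qed
  define w where "w i = \<bar>v $ i\<bar>" for i
  have le: "w j \<le> (\<Sum>i<n. w i * S $$ (i, j))" if "j < n" for j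
  proof -
    have "w j = \<bar>\<Sum>i<n. v $ i * S $$ (i, j)\<bar>" using fix_v that by (simp add: w_def)
    also have "\<dots> \<le> (\<Sum>i<n. \<bar>v $ i * S $$ (i, j)\<bar>)" by (rule sum_abs)
    also have "\<dots> = (\<Sum>i<n. w i * S $$ (i, j))"
      using nonneg that by (intro sum.cong) (auto simp: abs_mult w_def)
    finally show ?thesis .
  qed
  \<comment> \<open>Both sides of \<open>le\<close> have the same sum over \<open>j\<close>, so \<open>\<bar>v\<bar>\<close> is again a left eigenvector.\<close>
  have "(\<Sum>j<n. \<Sum>i<n. w i * S $$ (i, j)) = (\<Sum>i<n. \<Sum>j<n. w i * S $$ (i, j))"
    by (rule sum.swap)
  also have "\<dots> = (\<Sum>i<n. w i)"
    using rows by (intro sum.cong) (auto simp flip: sum_distrib_left)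
  finally have "(\<Sum>j<n. (\<Sum>i<n. w i * S $$ (i, j)) - w j) = 0"
    by (simp add: sum_subtractf)
  then have fix_w: "(\<Sum>i<n. w i * S $$ (i, j)) = w j" if "j < n" for j
    using le that by (subst (asm) sum_nonneg_eq_0_iff) auto
  obtain k where "k < n" "v $ k \<noteq> 0" using v by (metis eq_vecI index_zero_vec carrier_vecD)
  then have pos: "0 < (\<Sum>i<n. w i)"
    by (intro sum_pos2[of _ k]) (auto simp: w_def)
  define W where "W = (\<Sum>i<n. w i)"
  have W: "0 < W" using pos by (simp add: W_def)
  have "(\<Sum>i<n. w i / W) = 1" using W by (simp add: W_def flip: sum_divide_distrib)
  moreover have "0 \<le> w i / W" for i using W by (simp add: w_def)
  moreover have "(\<Sum>i<n. w i / W * S $$ (i, j)) = w j / W" if "j < n" for j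
    using fix_w[OF that] by (simp flip: sum_divide_distrib)
  ultimately have "stationary_density n S (vec n (\<lambda>i. w i / W))"
    by (simp add: stationary_density_def)
  then show ?thesis by blast
qed

section \<open>Gibbs' inequality with its equality case\<close>

text \<open>This is \<open>ln x \<le> x - 1\<close> at \<open>x = b / a\<close>, scaled by
  \<open>a\<close>, with equality only at \<open>x = 1\<close>; the factor \<open>1 / ln 2\<close>
  converts to base 2. The bound is linear in \<open>a - b\<close>, so that it cancels when summed
  over two families of equal mass.\<close>

lemma gibbs_term:
  fixes a b :: real
  assumes "0 \<le> a" "0 \<le> b" "b = 0 \<Longrightarrow> a = 0"
  shows gibbs_term_le: "(a - b) / ln 2 \<le> (if a = 0 then 0 else a * log 2 (a / b))"
    and gibbs_term_eq: "(if a = 0 then 0 else a * log 2 (a / b)) = (a - b) / ln 2 \<Longrightarrow> a = b"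
proof -
  have *: "(a - b) / ln 2 \<le> (if a = 0 then 0 else a * log 2 (a / b))
    \<and> ((if a = 0 then 0 else a * log 2 (a / b)) = (a - b) / ln 2 \<longrightarrow> a = b)"
  proof (cases "a = 0")
    case True
    \<comment> \<open>Here the claim reads \<open>- b / ln 2 \<le> 0\<close>, with equality only for
      \<open>b = 0\<close>.\<close>
    then show ?thesis using assms by auto
  next
    case False
    then have ab: "a > 0" "b > 0" using assms by (auto simp: less_le)
    have l: "a * log 2 (a / b) = - a * ln (b / a) / ln 2"
      using ab by (simp add: log_def ln_div algebra_simps)
    have "ln (b / a) \<le> b / a - 1" using ab by (intro ln_le_minus_one) simp
    then have "a * ln (b / a) \<le> a * (b / a - 1)" using ab by simp
    also have "\<dots> = b - a" using ab by (simp add: field_simps)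
    finally have "(a - b) / ln 2 \<le> a * log 2 (a / b)"
      unfolding l by (intro divide_right_mono) auto
    moreover have "a = b" if "a * log 2 (a / b) = (a - b) / ln 2"
    proof -
      have "ln (b / a) = b / a - 1" using that ab unfolding l by (simp add: field_simps)
      then have "b / a = 1" using ab by (intro ln_eq_minus_one) auto
      then show ?thesis using ab by simp
    qed
    ultimately show ?thesis using False by simp
  qed
  show "(a - b) / ln 2 \<le> (if a = 0 then 0 else a * log 2 (a / b))" using * by blast
  show "(if a = 0 then 0 else a * log 2 (a / b)) = (a - b) / ln 2 \<Longrightarrow> a = b" using * by blast
qed

text \<open>Kullback-Leibler divergence in bits. The guard is the one in
  \<open>entropy_production\<close>, so the two sums can be compared term by term.\<close>

definition relative_entropy :: "'a set \<Rightarrow> ('a \<Rightarrow> real) \<Rightarrow> ('a \<Rightarrow> real) \<Rightarrow> real" where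
  "relative_entropy A s t = (\<Sum>j\<in>A. if s j = 0 then 0 else s j * log 2 (s j / t j))"

lemma relative_entropy_self: "relative_entropy A s s = 0"
  by (auto simp: relative_entropy_def intro!: sum.neutral)

text \<open>The linear lower bounds of \<open>gibbs_term\<close> sum to 0 because the masses agree.
  So the divergence is the sum of the nonnegative gaps \<open>d j\<close>, and it vanishes only if
  every gap does.\<close>

lemma relative_entropy:
  assumes "finite A" "\<And>j. j \<in> A \<Longrightarrow> 0 \<le> s j" "\<And>j. j \<in> A \<Longrightarrow> 0 \<le> t j"
    and "\<And>j. j \<in> A \<Longrightarrow> t j = 0 \<Longrightarrow> s j = 0" and "sum s A = sum t A"
  shows relative_entropy_nonneg: "0 \<le> relative_entropy A s t"
    and relative_entropy_eq_0: "relative_entropy A s t = 0 \<Longrightarrow> j \<in> A \<Longrightarrow> s j = t j"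
proof -
  define d where "d j = (if s j = 0 then 0 else s j * log 2 (s j / t j)) - (s j - t j) / ln 2" for j
  have "(\<Sum>j\<in>A. (s j - t j) / ln 2) = 0"
    using assms(5) by (simp add: sum_subtractf flip: sum_divide_distrib)
  then have d_sum: "relative_entropy A s t = sum d A"
    by (simp add: relative_entropy_def d_def sum_subtractf)
  have d: "0 \<le> d j" if "j \<in> A" for j
    using gibbs_term_le[of "s j" "t j"] assms that by (simp add: d_def)
  show "0 \<le> relative_entropy A s t" unfolding d_sum using d by (rule sum_nonneg)
  assume "relative_entropy A s t = 0" "j \<in> A"
  then have "d j = 0" using d_sum d assms(1) by (simp add: sum_nonneg_eq_0_iff)
  then show "s j = t j"
    using gibbs_term_eq[of "s j" "t j"] assms \<open>j \<in> A\<close> unfolding d_def by auto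
qed

section \<open>Walks in the graph of a matrix\<close>

lemma mult_mat_entry_nonzero:
  fixes A B :: "real mat"
  assumes "A \<in> carrier_mat n n" "B \<in> carrier_mat n n" "i < n" "j < n" "(A * B) $$ (i, j) \<noteq> 0"
  obtains k where "k < n" "A $$ (i, k) \<noteq> 0" "B $$ (k, j) \<noteq> 0"
proof -
  have "(A * B) $$ (i, j) = (\<Sum>k<n. A $$ (i, k) * B $$ (k, j))"
    using assms by (simp add: scalar_prod_def atLeast0LessThan)
  then have "\<exists>k<n. A $$ (i, k) * B $$ (k, j) \<noteq> 0"
    using assms(5) by (metis (no_types, lifting) lessThan_iff sum.neutral)
  then show ?thesis using that by auto
qed

text \<open>A nonzero entry of the \<open>l\<close>-th power yields a walk of length
  \<open>l\<close> from \<open>i\<close> to \<open>j\<close>, and \<open>P\<close> is passed on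
  along each of its edges.\<close>

lemma closed_under_pow_mat:
  fixes M :: "real mat"
  assumes M: "M \<in> carrier_mat n n" and i: "i < n" "P i"
    and closed: "\<And>k j. k < n \<Longrightarrow> j < n \<Longrightarrow> P k \<Longrightarrow> M $$ (k, j) \<noteq> 0 \<Longrightarrow> P j"
  shows "j < n \<Longrightarrow> (M ^\<^sub>m l) $$ (i, j) \<noteq> 0 \<Longrightarrow> P j"
proof (induction l arbitrary: j)
  case 0
  \<comment> \<open>The power 0 is the identity matrix, so a nonzero entry forces
    \<open>j = i\<close>.\<close>
  then show ?case using M i by (auto split: if_splits)
next
  case (Suc l)
  then have "(M ^\<^sub>m l * M) $$ (i, j) \<noteq> 0" by simp
  then obtain k where "k < n" "(M ^\<^sub>m l) $$ (i, k) \<noteq> 0" "M $$ (k, j) \<noteq> 0"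
    using mult_mat_entry_nonzero[OF pow_carrier_mat[OF M] M i(1) Suc.prems(1)] by blast
  then show ?case using Suc closed by blast
qed

text \<open>The last edge of a closed walk through \<open>j\<close> ends in \<open>j\<close>; such
  an edge exists because \<open>l \<ge> 1\<close>.\<close>

lemma strongly_connected_column_nonzero:
  assumes M: "M \<in> carrier_mat n n" and sc: "strongly_connected n M" and j: "j < n"
  obtains k where "k < n" "M $$ (k, j) \<noteq> 0"
proof -
  obtain l where l: "l \<ge> 1" "(M ^\<^sub>m l) $$ (j, j) > 0"
    using sc j unfolding strongly_connected_def by blast
  then obtain m where "l = Suc m" by (cases l) auto
  then have "(M ^\<^sub>m m * M) $$ (j, j) \<noteq> 0" using l by simp
  then show ?thesis
    using mult_mat_entry_nonzero[OF pow_carrier_mat[OF M] M j j] that by blast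
qed

section \<open>The maximal entropy random walk\<close>

locale positive_eigenvector =
  fixes n :: nat and M :: "real mat" and lam :: real and \<psi> :: "real vec"
  assumes n: "n \<ge> 1"
    and M: "nonneg_matrix n M"
    and connected: "strongly_connected n M"
    and eigenvector: "eigenvector M \<psi> lam"
    and psi_pos: "\<And>i. i < n \<Longrightarrow> 0 < \<psi> $ i"
begin

abbreviation T :: "real mat" where "T \<equiv> merw n M lam \<psi>"

lemma M_carrier: "M \<in> carrier_mat n n"
  using M by (simp add: nonneg_matrix_def)

lemma M_nonneg: "i < n \<Longrightarrow> j < n \<Longrightarrow> 0 \<le> M $$ (i, j)"
  using M by (simp add: nonneg_matrix_def)

lemma eigenvector_sum:
  assumes "i < n"
  shows "(\<Sum>j<n. M $$ (i, j) * \<psi> $ j) = lam * \<psi> $ i"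
proof -
  have psi: "\<psi> \<in> carrier_vec n" "M *\<^sub>v \<psi> = lam \<cdot>\<^sub>v \<psi>"
    using eigenvector M_carrier by (auto simp: eigenvector_def)
  then have "(M *\<^sub>v \<psi>) $ i = lam * \<psi> $ i" using assms by simp
  moreover have "(M *\<^sub>v \<psi>) $ i = (\<Sum>j<n. M $$ (i, j) * \<psi> $ j)"
    using psi(1) M_carrier assms by (simp add: scalar_prod_def atLeast0LessThan)
  ultimately show ?thesis by simp
qed

text \<open>Strong connectivity gives an edge from some \<open>k\<close> to 0, which makes row
  \<open>k\<close> of \<open>M *\<^sub>v \<psi>\<close> positive; this row equals
  \<open>lam * \<psi> $ k\<close>.\<close>

lemma lam_pos: "0 < lam"
proof -
  obtain k where k: "k < n" "M $$ (k, 0) \<noteq> 0"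
    using strongly_connected_column_nonzero[OF M_carrier connected, of 0] n by auto
  have "0 < M $$ (k, 0) * \<psi> $ 0"
    using k M_nonneg[of k 0] psi_pos[of 0] n by (simp add: less_le)
  then have "0 < (\<Sum>j<n. M $$ (k, j) * \<psi> $ j)"
    using n k M_nonneg psi_pos
    by (intro sum_pos2[of _ 0]) (auto intro!: mult_nonneg_nonneg simp: less_imp_le)
  then show ?thesis
    using eigenvector_sum[OF k(1)] psi_pos[OF k(1)] by (simp add: zero_less_mult_iff)
qed

lemma merw_entry:
  "i < n \<Longrightarrow> j < n \<Longrightarrow> T $$ (i, j) = M $$ (i, j) / lam * (\<psi> $ j / \<psi> $ i)"
  by (simp add: merw_def)

lemma merw_carrier: "T \<in> carrier_mat n n"
  by (simp add: merw_def)

lemma merw_nonneg: "i < n \<Longrightarrow> j < n \<Longrightarrow> 0 \<le> T $$ (i, j)"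
  using M_nonneg lam_pos psi_pos by (simp add: merw_entry less_imp_le)

lemma merw_eq_0_iff: "i < n \<Longrightarrow> j < n \<Longrightarrow> T $$ (i, j) = 0 \<longleftrightarrow> M $$ (i, j) = 0"
  using lam_pos psi_pos[of i] psi_pos[of j] by (simp add: merw_entry)

lemma merw_row_sum:
  assumes "i < n"
  shows "(\<Sum>j<n. T $$ (i, j)) = 1"
proof -
  have "(\<Sum>j<n. T $$ (i, j)) = (\<Sum>j<n. M $$ (i, j) * \<psi> $ j / (lam * \<psi> $ i))"
    using assms by (intro sum.cong) (auto simp: merw_entry)
  also have "\<dots> = 1"
    using eigenvector_sum[OF assms] lam_pos psi_pos[OF assms] by (simp flip: sum_divide_distrib)
  finally show ?thesis .
qed

lemma merw_stochastic: "stochastic_on n M T"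
proof -
  have "T $$ (i, j) \<le> 1" if "i < n" "j < n" for i j
  proof -
    have "T $$ (i, j) \<le> (\<Sum>j<n. T $$ (i, j))"
      using that merw_nonneg by (intro member_le_sum) auto
    then show ?thesis using merw_row_sum that by simp
  qed
  then show ?thesis
    using merw_carrier merw_nonneg merw_row_sum merw_eq_0_iff by (simp add: stochastic_on_def)
qed

section \<open>Entropy production as a deficit from lg of the eigenvalue\<close>

text \<open>The value at \<open>T\<close>, the upper bound and the equality case are all read off
  this exact identity.\<close>

lemma entropy_production_eq:
  assumes S: "stochastic_on n M S" and q: "stationary_density n S q"
  shows "entropy_production n M S q =
    log 2 lam - (\<Sum>i<n. q $ i * relative_entropy {..<n} (\<lambda>j. S $$ (i, j)) (\<lambda>j. T $$ (i, j)))"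
proof -
  define g where "g i = log 2 (\<psi> $ i)" for i
  define D where "D i = relative_entropy {..<n} (\<lambda>j. S $$ (i, j)) (\<lambda>j. T $$ (i, j))" for i
  have rows: "(\<Sum>j<n. S $$ (i, j)) = 1" if "i < n" for i
    using S that by (simp add: stochastic_on_def)
  have q_sum: "(\<Sum>i<n. q $ i) = 1" and q_fix: "\<And>j. j < n \<Longrightarrow> (\<Sum>i<n. q $ i * S $$ (i, j)) = q $ j"
    using q by (auto simp: stationary_density_def)
  \<comment> \<open>Where \<open>S\<close> is positive, so are \<open>M\<close> and
    \<open>T\<close>, and the logarithm of \<open>T $$ (i, j)\<close> splits; the eigenvector enters
    only through the increment \<open>g j - g i\<close> of a potential.\<close>
  have entry: "(if S $$ (i, j) = 0 then 0 else S $$ (i, j) * log 2 (S $$ (i, j) / M $$ (i, j))) =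
      (if S $$ (i, j) = 0 then 0 else S $$ (i, j) * log 2 (S $$ (i, j) / T $$ (i, j)))
      - S $$ (i, j) * (log 2 lam + g i) + S $$ (i, j) * g j" if ij: "i < n" "j < n" for i j
  proof (cases "S $$ (i, j) = 0")
    case False
    then have "0 < S $$ (i, j)" "M $$ (i, j) \<noteq> 0"
      using S ij by (auto simp: stochastic_on_def less_le)
    moreover from this have "0 < M $$ (i, j)" using M_nonneg ij by (simp add: less_le)
    ultimately have "log 2 (S $$ (i, j) / T $$ (i, j)) =
        log 2 (S $$ (i, j) / M $$ (i, j)) + log 2 lam + g i - g j"
      using ij lam_pos psi_pos[of i] psi_pos[of j]
      by (simp add: merw_entry g_def log_divide log_mult)
    then show ?thesis using False by (simp add: right_diff_distrib distrib_left)
  qed simp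
  have row: "(\<Sum>j<n. if S $$ (i, j) = 0 then 0 else S $$ (i, j) * log 2 (S $$ (i, j) / M $$ (i, j))) =
      D i - (log 2 lam + g i) + (\<Sum>j<n. S $$ (i, j) * g j)" if i: "i < n" for i
    using i rows[OF i]
    by (simp add: entry D_def relative_entropy_def sum.distrib sum_subtractf flip: sum_distrib_right)
  \<comment> \<open>By stationarity the mean of \<open>g\<close> after one step is its mean before,
    so the increments average to 0.\<close>
  have "(\<Sum>i<n. q $ i * (\<Sum>j<n. S $$ (i, j) * g j)) = (\<Sum>i<n. \<Sum>j<n. q $ i * S $$ (i, j) * g j)"
    by (simp add: sum_distrib_left mult.assoc)
  also have "\<dots> = (\<Sum>j<n. \<Sum>i<n. q $ i * S $$ (i, j) * g j)" by (rule sum.swap)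
  also have "\<dots> = (\<Sum>j<n. q $ j * g j)" by (simp add: q_fix flip: sum_distrib_right)
  finally have cancel: "(\<Sum>i<n. q $ i * (\<Sum>j<n. S $$ (i, j) * g j)) = (\<Sum>j<n. q $ j * g j)" .
  have "entropy_production n M S q =
      - (\<Sum>i<n. q $ i * (D i - (log 2 lam + g i) + (\<Sum>j<n. S $$ (i, j) * g j)))"
    unfolding entropy_production_def using row by simp
  also have "\<dots> = - ((\<Sum>i<n. q $ i * D i) - (\<Sum>i<n. q $ i) * log 2 lam - (\<Sum>i<n. q $ i * g i)
      + (\<Sum>i<n. q $ i * (\<Sum>j<n. S $$ (i, j) * g j)))"
    by (simp add: ring_distribs sum.distrib sum_subtractf sum_distrib_right)
  also have "\<dots> = log 2 lam - (\<Sum>i<n. q $ i * D i)"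
    using cancel q_sum by simp
  finally show ?thesis by (simp add: D_def)
qed

lemma entropy_production_merw:
  "stationary_density n T p \<Longrightarrow> entropy_production n M T p = log 2 lam"
  by (simp add: entropy_production_eq merw_stochastic relative_entropy_self)

section \<open>Maximality and uniqueness\<close>

lemma entropy_production:
  assumes S: "stochastic_on n M S" and q: "stationary_density n S q"
  shows entropy_production_le: "entropy_production n M S q \<le> log 2 lam"
    and entropy_production_eq_max: "entropy_production n M S q = log 2 lam \<Longrightarrow> S = T"
proof -
  define D where "D i = relative_entropy {..<n} (\<lambda>j. S $$ (i, j)) (\<lambda>j. T $$ (i, j))" for i
  have S_carrier: "S \<in> carrier_mat n n" and S_nonneg: "\<And>i j. i < n \<Longrightarrow> j < n \<Longrightarrow> 0 \<le> S $$ (i, j)"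
    and S_rows: "\<And>i. i < n \<Longrightarrow> (\<Sum>j<n. S $$ (i, j)) = 1"
    and S_0: "\<And>i j. i < n \<Longrightarrow> j < n \<Longrightarrow> M $$ (i, j) = 0 \<Longrightarrow> S $$ (i, j) = 0"
    using S by (auto simp: stochastic_on_def)
  have q_nonneg: "\<And>i. i < n \<Longrightarrow> 0 \<le> q $ i" and q_sum: "(\<Sum>i<n. q $ i) = 1"
    and q_fix: "\<And>j. j < n \<Longrightarrow> (\<Sum>i<n. q $ i * S $$ (i, j)) = q $ j"
    using q by (auto simp: stationary_density_def)
  have D_nonneg: "0 \<le> D i" if "i < n" for i
    unfolding D_def using that
    by (intro relative_entropy_nonneg)
       (auto simp: S_nonneg merw_nonneg S_0 merw_eq_0_iff S_rows merw_row_sum)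
  have D_0: "S $$ (i, j) = T $$ (i, j)" if "i < n" "j < n" "D i = 0" for i j
    using that unfolding D_def
    by (intro relative_entropy_eq_0[of "{..<n}" "\<lambda>j. S $$ (i, j)" "\<lambda>j. T $$ (i, j)" j])
       (auto simp: S_nonneg merw_nonneg S_0 merw_eq_0_iff S_rows merw_row_sum)
  have H: "entropy_production n M S q = log 2 lam - (\<Sum>i<n. q $ i * D i)"
    unfolding D_def using S q by (rule entropy_production_eq)
  have "0 \<le> (\<Sum>i<n. q $ i * D i)"
    using q_nonneg D_nonneg by (intro sum_nonneg) simp
  then show "entropy_production n M S q \<le> log 2 lam" using H by simp
  assume "entropy_production n M S q = log 2 lam"
  then have "(\<Sum>i<n. q $ i * D i) = 0" using H by simp
  then have "\<forall>i<n. q $ i * D i = 0"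
    using q_nonneg D_nonneg by (subst (asm) sum_nonneg_eq_0_iff) auto
  \<comment> \<open>Equality gives information only about rows carrying mass, and \<open>q\<close>
    might vanish on some vertices; the rest of the proof rules this out.\<close>
  then have supp: "D i = 0" if "i < n" "0 < q $ i" for i using that by auto
  \<comment> \<open>Row \<open>k\<close> of \<open>S\<close> is that of \<open>T\<close>, which is
    positive on every edge of \<open>M\<close>. So mass at \<open>k\<close> flows to
    \<open>j\<close> in one step, and stationarity returns it as \<open>q $ j\<close>.\<close>
  have closed: "0 < q $ j" if kj: "k < n" "j < n" "0 < q $ k" "M $$ (k, j) \<noteq> 0" for k j
  proof -
    have "0 < S $$ (k, j)"
      using D_0[OF kj(1,2) supp[OF kj(1,3)]] merw_nonneg[OF kj(1,2)] merw_eq_0_iff[OF kj(1,2)] kj(4)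
      by (simp add: less_le)
    then have "0 < (\<Sum>i<n. q $ i * S $$ (i, j))"
      using kj q_nonneg S_nonneg by (intro sum_pos2[of _ k]) auto
    then show ?thesis using q_fix kj by simp
  qed
  have "\<exists>i<n. q $ i \<noteq> 0"
  proof (rule ccontr)
    assume "\<not> ?thesis"
    then have "(\<Sum>i<n. q $ i) = 0" by (intro sum.neutral) auto
    then show False using q_sum by simp
  qed
  then obtain i where i: "i < n" "0 < q $ i" using q_nonneg by (auto simp: less_le)
  have q_pos: "0 < q $ j" if j: "j < n" for j
  proof -
    obtain l where "(M ^\<^sub>m l) $$ (i, j) > 0"
      using connected i j unfolding strongly_connected_def by blast
    then have "(M ^\<^sub>m l) $$ (i, j) \<noteq> 0" by simp
    with M_carrier i closed j show ?thesis
      by (rule closed_under_pow_mat[where P = "\<lambda>k. 0 < q $ k"])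
  qed
  have "S $$ (i, j) = T $$ (i, j)" if "i < n" "j < n" for i j
    using that supp[OF that(1) q_pos[OF that(1)]] by (rule D_0)
  with S_carrier merw_carrier show "S = T"
    by (intro eq_matI) (simp_all only: carrier_matD)
qed

end

theorem mainTheorem5:
  fixes n :: nat and M :: "real mat" and lam :: real and \<psi> :: "real vec"
  assumes "n \<ge> 1"
    and "nonneg_matrix n M"
    and "strongly_connected n M"
    and "lam = spectral_radius (map_mat complex_of_real M)"
    and "eigenvector M \<psi> lam"
    and "\<forall>i<n. 0 < \<psi> $ i"
  shows "stochastic_on n M (merw n M lam \<psi>)
    \<and> (\<exists>p. stationary_density n (merw n M lam \<psi>) p)
    \<and> (\<forall>p. stationary_density n (merw n M lam \<psi>) p \<longrightarrow>
         entropy_production n M (merw n M lam \<psi>) p = log 2 lam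
         \<and> (\<forall>S q. stochastic_on n M S \<and> stationary_density n S q \<longrightarrow>
              entropy_production n M S q \<le> entropy_production n M (merw n M lam \<psi>) p
              \<and> (entropy_production n M S q = entropy_production n M (merw n M lam \<psi>) p
                   \<longrightarrow> S = merw n M lam \<psi>)))"
proof -
  interpret positive_eigenvector n M lam \<psi>
    using assms by unfold_locales auto
  \<comment> \<open>This keeps the quantification over \<open>p\<close> from being vacuous. Every
    such \<open>p\<close> gives the value \<open>log 2 lam\<close>, so the comparison with
    \<open>T\<close> becomes one with that number.\<close>
  have "\<exists>p. stationary_density n T p"
    using merw_carrier n merw_nonneg merw_row_sum by (rule stationary_density_exists)
  then show ?thesis
    by (auto simp: merw_stochastic entropy_production_merw entropy_production_le
        intro: entropy_production_eq_max)
qed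

end
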